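(* Let $(X,\mathcal R)$ be a $d$-class association scheme with adjacency matrices $A_0,A_1,\dots,A_d$ and intersection numbers $p_{i,j}^k$. Let $\Pi$ be an equitable partition of $(X,\mathcal R)$ with $t$ cells, all of the same size $\frac{|X|}{t}$, and let $M_i$ be the quotient matrix of $A_i$ with respect to $\Pi$. Let $I=\{i_1,\dots,i_s\}\subseteq\{0,1,\dots,d\}$ and let $p$ be a prime number such that $p\mid p_{i,j}^k$ for all $k\in\{0,1,\dots,d\}$ and all $i,j\in I$. Let $q=p^r$ for a positive integer $r$, and let $\overline{\mathcal M}$ be the matrix algebra over $\mathbb F_q$ generated by the matrices $M_i$, $i\in I$; assume $\overline{\mathcal M}\neq\{0\}$. Then the set of row spaces of the matrices $$\left[\begin{array}{c|c} Y & \alpha I_t\end{array}\right],\qquad Y\in\overline{\mathcal M}\setminus\{0\},\ \alpha\in\mathbb F_q\setminus\{0\},$$ is an LCD subspace code $C_S$ of subspaces of $\mathbb F_q^{2t}$.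
   Context: An association scheme with $d$ classes is a pair $(X,\mathcal R)$ with $X$ a finite set and $\mathcal R=\{R_0,\dots,R_d\}$ a partition of $X\times X$ such that $R_0=\{(x,x):x\in X\}$, each $R_i$ is symmetric, and there are numbers $p_{i,j}^k$ (intersection numbers) such that for every $(x,y)\in R_k$ the number of $z\in X$ with $(x,z)\in R_i$ and $(z,y)\in R_j$ equals $p_{i,j}^k$. The adjacency matrix $A_i$ is the $(0,1)$-matrix indexed by $X$ whose $(x,y)$ entry is $1$ iff $(x,y)\in R_i$. Given a partition $\Pi=\{X_1,\dots,X_t\}$ of the index set of a square matrix $A$, partition $A$ into blocks $A_{ij}$ (rows in $X_i$, columns in $X_j$). $\Pi$ is equitable for $A$ if every block $A_{ij}$ has constant row sum and constant column sum; the quotient matrix of $A$ is the $t\times t$ matrix whose $(i,j)$ entry is the (average, here constant) row sum of $A_{ij}$. A partition of $X$ is an equitable partition of $(X,\mathcal R)$ if it is equitable for each $A_i$. The integer matrices $M_i$ are reduced modulo $p$ and regarded as matrices over $\mathbb F_q$. The matrix algebra generated by a set of matrices is the $\mathbb F_q$-linear span of all finite products (of length at least one) of these matrices; the identity matrix is not adjoined. $I_t$ is the identity matrix of order $t$. A subspace code is a nonempty set of subspaces of a vector space $\mathbb F_q^N$. A subspace code $C_S$ is an LCD subspace code if $U\cap W^\perp=\{0\}$ for all $U,W\in C_S$ (including $U=W$), where $\perp$ is with respect to the Euclidean inner product. *)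

theory Defs
  imports
    "HOL-Library.Disjoint_Sets"
    "HOL-Library.Cardinality"
    "HOL-Computational_Algebra.Primes"
    "Jordan_Normal_Form.VS_Connect"
begin

text \<open>\<open>P i j k\<close> stands for $p_{i,j}^k$; its values at indices above \<open>d\<close> are irrelevant.\<close>

definition intersection_numbers ::
  "'a set \<Rightarrow> nat \<Rightarrow> (nat \<Rightarrow> ('a \<times> 'a) set) \<Rightarrow> (nat \<Rightarrow> nat \<Rightarrow> nat \<Rightarrow> nat) \<Rightarrow> bool" where
  "intersection_numbers X d R P \<longleftrightarrow>
     (\<forall>i\<le>d. \<forall>j\<le>d. \<forall>k\<le>d. \<forall>(x, y)\<in>R k.
        card {z \<in> X. (x, z) \<in> R i \<and> (z, y) \<in> R j} = P i j k)"

text \<open>The constant \<^const>\<open>partition_on\<close> requires nonempty blocks, so every \<open>R i\<close> with \<open>i \<le> d\<close> is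
  nonempty (hence so is \<open>X\<close>) and the intersection numbers are uniquely determined.\<close>

definition association_scheme ::
  "'a set \<Rightarrow> nat \<Rightarrow> (nat \<Rightarrow> ('a \<times> 'a) set) \<Rightarrow> bool" where
  "association_scheme X d R \<longleftrightarrow>
     finite X \<and>
     partition_on (X \<times> X) (R ` {0..d}) \<and> inj_on R {0..d} \<and>
     R 0 = {(x, x) | x. x \<in> X} \<and>
     (\<forall>i\<le>d. sym (R i)) \<and>
     (\<exists>P. intersection_numbers X d R P)"

text \<open>Matrices indexed by \<open>X\<close> are functions \<open>'a \<Rightarrow> 'a \<Rightarrow> int\<close>, read on \<open>X \<times> X\<close> only.
  A partition is given as a list of its cells, which fixes the order of the
  rows and columns of the quotient matrix.\<close>

definition adjacency :: "('a \<times> 'a) set \<Rightarrow> 'a \<Rightarrow> 'a \<Rightarrow> int" where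
  "adjacency E x y = (if (x, y) \<in> E then 1 else 0)"

definition cell_partition :: "'a set \<Rightarrow> 'a set list \<Rightarrow> bool" where
  "cell_partition X cells \<longleftrightarrow> distinct cells \<and> partition_on X (set cells)"

definition equitable_for :: "'a set list \<Rightarrow> ('a \<Rightarrow> 'a \<Rightarrow> int) \<Rightarrow> bool" where
  "equitable_for cells A \<longleftrightarrow>
     (\<forall>C\<in>set cells. \<forall>D\<in>set cells.
        (\<exists>r. \<forall>x\<in>C. (\<Sum>y\<in>D. A x y) = r) \<and>
        (\<exists>c. \<forall>y\<in>D. (\<Sum>x\<in>C. A x y) = c))"

definition equitable_partition ::
  "'a set \<Rightarrow> nat \<Rightarrow> (nat \<Rightarrow> ('a \<times> 'a) set) \<Rightarrow> 'a set list \<Rightarrow> bool" where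
  "equitable_partition X d R cells \<longleftrightarrow>
     cell_partition X cells \<and> (\<forall>i\<le>d. equitable_for cells (adjacency (R i)))"

definition quotient_matrix :: "'a set list \<Rightarrow> ('a \<Rightarrow> 'a \<Rightarrow> int) \<Rightarrow> rat mat" where
  "quotient_matrix cells A =
     mat (length cells) (length cells) (\<lambda>(i, j).
       (\<Sum>x\<in>cells ! i. \<Sum>y\<in>cells ! j. of_int (A x y)) / of_nat (card (cells ! i)))"

text \<open>Reduction modulo the characteristic is only meaningful for integral entries, on which the
  floor is the identity. By the lemma below, quotient matrices of equitable partitions
  have integral entries.\<close>

definition reduce_matrix :: "rat mat \<Rightarrow> 'k::field mat" where
  "reduce_matrix M = map_mat (\<lambda>c. of_int \<lfloor>c\<rfloor>) M"

lemma quotient_matrix_equitable: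
  assumes "finite X" "cell_partition X cells" "equitable_for cells A"
    and "i < length cells" "j < length cells" "x \<in> cells ! i"
  shows "quotient_matrix cells A $$ (i, j) = of_int (\<Sum>y\<in>cells ! j. A x y)"
proof -
  have mem: "cells ! i \<in> set cells" "cells ! j \<in> set cells"
    using assms by auto
  then obtain r where r: "\<And>z. z \<in> cells ! i \<Longrightarrow> (\<Sum>y\<in>cells ! j. A z y) = r"
    using assms(3) unfolding equitable_for_def by meson
  have "finite (cells ! i)"
    using assms(1,2) mem(1) unfolding cell_partition_def partition_on_def
    by (metis Sup_upper finite_subset)
  then have card: "card (cells ! i) \<noteq> 0"
    using assms(6) by auto
  have "(\<Sum>z\<in>cells ! i. \<Sum>y\<in>cells ! j. rat_of_int (A z y)) = (\<Sum>z\<in>cells ! i. rat_of_int r)"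
    by (intro sum.cong refl) (simp flip: r)
  then show ?thesis
    using assms(4,5) card r[OF assms(6)] unfolding quotient_matrix_def by simp
qed

inductive_set matrix_products :: "'k::field mat set \<Rightarrow> 'k mat set" for S where
  single: "A \<in> S \<Longrightarrow> A \<in> matrix_products S"
| mult: "A \<in> matrix_products S \<Longrightarrow> B \<in> S \<Longrightarrow> A * B \<in> matrix_products S"

text \<open>The generated algebra is not required to contain the identity matrix.\<close>

definition generated_algebra :: "nat \<Rightarrow> 'k::field mat set \<Rightarrow> 'k mat set" where
  "generated_algebra n S =
     LinearCombinations.module.span class_ring (module_mat TYPE('k) n n) (matrix_products S)"

definition append_columns :: "'k::zero mat \<Rightarrow> 'k mat \<Rightarrow> 'k mat" where
  "append_columns A B = four_block_mat A B (0\<^sub>m 0 (dim_col A)) (0\<^sub>m 0 (dim_col B))"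

definition subspace_code :: "nat \<Rightarrow> 'k::field vec set set \<Rightarrow> bool" where
  "subspace_code N CS \<longleftrightarrow>
     CS \<noteq> {} \<and> (\<forall>U\<in>CS. subspace class_ring U (module_vec TYPE('k) N))"

definition lcd_subspace_code :: "nat \<Rightarrow> 'k::field vec set set \<Rightarrow> bool" where
  "lcd_subspace_code N CS \<longleftrightarrow>
     subspace_code N CS \<and>
     (\<forall>U\<in>CS. \<forall>W\<in>CS. U \<inter> vec_module.orthogonal_complement N W = {0\<^sub>v N})"

end

theory Submission
  imports Defs
begin

text \<open>
  Write \<open>G\<close> for a generator matrix \<open>[Y | \<alpha> I]\<close> of the code and \<open>H\<close> for another one \<open>[Z | \<beta> I]\<close>.
  A vector of the row space of \<open>G\<close> is \<open>G\<^sup>T v\<close>, and it is orthogonal to the row space of \<open>H\<close>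
  iff \<open>H G\<^sup>T v = 0\<close>. Since \<open>H G\<^sup>T = Z Y\<^sup>T + \<beta>\<alpha> I\<close>, everything follows once \<open>Z Y\<^sup>T = 0\<close> for all
  \<open>Y\<close>, \<open>Z\<close> in the algebra: then \<open>\<beta>\<alpha> v = 0\<close> and so \<open>v = 0\<close>
  (lemma \<open>row_space_inter_orthogonal_complement\<close>).

  Two facts about the reduced quotient matrices with index in \<open>I\<close> give \<open>Z Y\<^sup>T = 0\<close>. Any product of two
  of them vanishes: taking quotients by an equitable partition is multiplicative, so the relation
  \<open>A\<^sub>i A\<^sub>j = (\<Sum>k. p\<^sub>i\<^sub>j\<^sup>k A\<^sub>k)\<close> passes to the quotients, where all its coefficients are \<open>0\<close> in
  characteristic \<open>p\<close> (lemma \<open>reduced_quotient_mult_eq_0\<close>). Each of them is symmetric: \<open>A\<^sub>i\<close> is symmetric,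
  so the blocks \<open>(a, b)\<close> and \<open>(b, a)\<close> have the same total, and their average row sums agree because the
  cells have equal size (lemma \<open>reduced_quotient_symmetric\<close>). Hence the algebra is just the linear
  span of its generators, and bilinearity extends \<open>Z Y\<^sup>T = 0\<close> from generators to the algebra
  (lemma \<open>generated_algebra_mult_transpose\<close>).
\<close>

section \<open>Row spaces of matrices with scalar Gram product\<close>

text \<open>A vector \<open>A\<^sup>T v\<close> orthogonal to the rows of \<open>B\<close> satisfies \<open>0 = B A\<^sup>T v = c v\<close>, which forces \<open>v = 0\<close>.
  For \<open>A = B\<close> this is a case of Massey's criterion: an invertible Gram matrix makes the row space LCD.\<close>

lemma row_space_inter_orthogonal_complement:
  fixes A B :: "'k::field mat"
  assumes A: "A \<in> carrier_mat m n" and B: "B \<in> carrier_mat m n"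
    and gram: "B * A\<^sup>T = c \<cdot>\<^sub>m 1\<^sub>m m" and "c \<noteq> 0"
  shows "vec_space.row_space n A \<inter> vec_module.orthogonal_complement n (vec_space.row_space n B)
    = {0\<^sub>v n}"
proof -
  interpret vec_space "TYPE('k)" n .
  have zero: "0\<^sub>v n \<in> row_space A"
    unfolding row_space_eq[OF A] using A
    by (auto intro!: bexI[of _ "0\<^sub>v m"])
  have B_sub: "row_space B \<subseteq> carrier_vec n"
    unfolding row_space_eq[OF B] using B by auto
  have "u = 0\<^sub>v n" if u: "u \<in> row_space A" and perp: "u \<in> orthogonal_complement (row_space B)" for u
  proof -
    from u obtain v where v: "v \<in> carrier_vec m" and uv: "u = A\<^sup>T *\<^sub>v v"
      unfolding row_space_eq[OF A] using A by auto
    have u_carrier: "u \<in> carrier_vec n"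
      using A v uv by auto
    have "B *\<^sub>v u = (B * A\<^sup>T) *\<^sub>v v"
      unfolding uv using A B v by (simp add: assoc_mult_mat_vec[of _ m n _ m])
    also have "\<dots> = c \<cdot>\<^sub>v v"
      unfolding gram using v
      by (intro eq_vecI) auto
    finally have Bu: "B *\<^sub>v u = c \<cdot>\<^sub>v v" .
    have "w \<bullet> (c \<cdot>\<^sub>v v) = 0" if w: "w \<in> carrier_vec m" for w
    proof -
      have "B\<^sup>T *\<^sub>v w \<in> row_space B"
        unfolding row_space_eq[OF B] using B w by auto
      then have "u \<bullet> (B\<^sup>T *\<^sub>v w) = 0"
        using perp unfolding orthogonal_complement_def by blast
      then show ?thesis
        using transpose_vec_mult_scalar[OF B u_carrier w] B w u_carrier Bu
        by (metis comm_scalar_prod mult_mat_vec_carrier transpose_carrier_mat)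
    qed
    \<comment> \<open>Pairing with the unit vectors shows that every coordinate of \<open>c v\<close> is zero.\<close>
    then have unit: "unit_vec m i \<bullet> (c \<cdot>\<^sub>v v) = 0" for i
      by simp
    have "v = 0\<^sub>v m"
    proof (rule eq_vecI)
      show "v $ i = 0\<^sub>v m $ i" if "i < dim_vec (0\<^sub>v m)" for i
        using unit[of i] that v \<open>c \<noteq> 0\<close> scalar_prod_left_unit[of "c \<cdot>\<^sub>v v" m i] by simp
    qed (use v in simp)
    then show ?thesis
      using A uv by auto
  qed
  moreover have "0\<^sub>v n \<in> orthogonal_complement (row_space B)"
    using B_sub unfolding orthogonal_complement_def by auto
  ultimately show ?thesis
    using zero by blast
qed

lemma append_columns_carrier:
  assumes "A \<in> carrier_mat m n" "B \<in> carrier_mat m k"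
  shows "append_columns A B \<in> carrier_mat m (n + k)"
  using assms unfolding append_columns_def by auto

text \<open>The two empty lower blocks in the definition of \<^const>\<open>append_columns\<close> contribute only empty
  blocks to the product.\<close>

lemma append_columns_mult_transpose:
  fixes A B C D :: "'k::field mat"
  assumes A: "A \<in> carrier_mat m n" and B: "B \<in> carrier_mat m k"
    and C: "C \<in> carrier_mat l n" and D: "D \<in> carrier_mat l k"
  shows "append_columns A B * (append_columns C D)\<^sup>T = A * C\<^sup>T + B * D\<^sup>T"
proof -
  have "append_columns A B * (append_columns C D)\<^sup>T =
    four_block_mat A B (0\<^sub>m 0 n) (0\<^sub>m 0 k) * four_block_mat C\<^sup>T (0\<^sub>m n 0) D\<^sup>T (0\<^sub>m k 0)"
    using A B C D unfolding append_columns_def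
    by (simp add: transpose_four_block_mat[OF C D zero_carrier_mat zero_carrier_mat])
  also have "\<dots> = four_block_mat (A * C\<^sup>T + B * D\<^sup>T) (A * 0\<^sub>m n 0 + B * 0\<^sub>m k 0)
      (0\<^sub>m 0 n * C\<^sup>T + 0\<^sub>m 0 k * D\<^sup>T) (0\<^sub>m 0 n * 0\<^sub>m n 0 + 0\<^sub>m 0 k * 0\<^sub>m k 0)"
    using A B C D by (intro mult_four_block_mat) auto
  also have "\<dots> = A * C\<^sup>T + B * D\<^sup>T"
    using A B C D by (intro eq_matI) auto
  finally show ?thesis .
qed

section \<open>Algebras generated by matrices with vanishing products\<close>

text \<open>The matrices satisfying \<open>Q\<close> form a subspace, and the span is the least subspace above \<open>T\<close>. As
  a rule it applies separately to each factor of a bilinear expression.\<close>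

lemma mat_span_induct [consumes 2, case_names gen zero add smult]:
  fixes T :: "'k::field mat set"
  assumes Y: "Y \<in> LinearCombinations.module.span class_ring (module_mat TYPE('k) m n) T"
    and T: "T \<subseteq> carrier_mat m n"
    and gen: "\<And>A. A \<in> T \<Longrightarrow> Q A"
    and zero: "Q (0\<^sub>m m n)"
    and add: "\<And>A B. A \<in> carrier_mat m n \<Longrightarrow> B \<in> carrier_mat m n \<Longrightarrow> Q A \<Longrightarrow> Q B \<Longrightarrow> Q (A + B)"
    and smult: "\<And>c A. A \<in> carrier_mat m n \<Longrightarrow> Q A \<Longrightarrow> Q (c \<cdot>\<^sub>m A)"
  shows "Y \<in> carrier_mat m n \<and> Q Y"
proof -
  interpret matrix_vs m n "TYPE('k)" .
  have "submodule class_ring {A \<in> carrier_mat m n. Q A} V"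
    using zero add smult module_axioms
    by (intro submodule.intro) (auto simp: module_mat_simps)
  then have "span T \<subseteq> {A \<in> carrier_mat m n. Q A}"
    using T gen by (intro span_is_subset) auto
  then show ?thesis
    using Y by auto
qed

lemma matrix_products_carrier:
  assumes "S \<subseteq> carrier_mat n n"
  shows "matrix_products S \<subseteq> carrier_mat n n"
proof
  show "A \<in> carrier_mat n n" if "A \<in> matrix_products S" for A
    using that by induction (use assms in auto)
qed

lemma generated_algebra_carrier:
  assumes "S \<subseteq> carrier_mat n n"
  shows "generated_algebra n S \<subseteq> carrier_mat n n"
  using mat_span_induct[OF _ matrix_products_carrier[OF assms], of _ "\<lambda>_. True"]
  unfolding generated_algebra_def by auto

text \<open>Since all products of two generators vanish, a product of generators is either zero or a
  single generator. For these the claim is the hypothesis on \<open>S\<close>, the transpose being harmless by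
  symmetry; bilinearity does the rest, first in \<open>Y\<close>, then in \<open>Z\<close>.\<close>

lemma generated_algebra_mult_transpose:
  fixes S :: "'k::field mat set"
  assumes S: "S \<subseteq> carrier_mat n n"
    and sym: "\<And>A. A \<in> S \<Longrightarrow> A\<^sup>T = A"
    and null: "\<And>A B. A \<in> S \<Longrightarrow> B \<in> S \<Longrightarrow> A * B = 0\<^sub>m n n"
    and Y: "Y \<in> generated_algebra n S" and Z: "Z \<in> generated_algebra n S"
  shows "Y * Z\<^sup>T = 0\<^sub>m n n"
proof -
  let ?T = "matrix_products S"
  have T: "A = 0\<^sub>m n n \<or> A \<in> S" if "A \<in> ?T" for A
    using that
  proof induction
    case (mult A B)
    then show ?case using S null by auto
  qed auto
  have T_carrier: "?T \<subseteq> carrier_mat n n"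
    by (rule matrix_products_carrier[OF S])
  have T_null: "A * B\<^sup>T = 0\<^sub>m n n" if "A \<in> ?T" "B \<in> ?T" for A B
    using T[OF that(1)] T[OF that(2)] S sym null by auto
  have left: "Y \<in> carrier_mat n n \<and> Y * B\<^sup>T = 0\<^sub>m n n" if "Y \<in> generated_algebra n S" "B \<in> ?T" for Y B
    using that(1) T_carrier unfolding generated_algebra_def
  proof (induction rule: mat_span_induct)
    case (gen A)
    then show ?case using T_null that(2) by auto
  next
    case zero
    then show ?case using that(2) T_carrier by auto
  next
    case (add A C)
    moreover have "B \<in> carrier_mat n n" using that(2) T_carrier by auto
    ultimately show ?case by (simp add: add_mult_distrib_mat[of _ n n])
  next
    case (smult c A)
    moreover have "B \<in> carrier_mat n n" using that(2) T_carrier by auto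
    ultimately show ?case by (simp add: mult_smult_assoc_mat[of _ n n _ n])
  qed
  have Y_carrier: "Y \<in> carrier_mat n n"
    using generated_algebra_carrier[OF S] Y by auto
  have "Z \<in> carrier_mat n n \<and> Y * Z\<^sup>T = 0\<^sub>m n n"
    using Z T_carrier unfolding generated_algebra_def
  proof (induction rule: mat_span_induct)
    case (gen A)
    then show ?case using left[OF Y] by auto
  next
    case zero
    then show ?case using Y_carrier by auto
  next
    case (add A C)
    then show ?case
      using Y_carrier by (simp add: transpose_add[of _ n n] mult_add_distrib_mat[of _ n n])
  next
    case (smult c A)
    moreover have "(c \<cdot>\<^sub>m A)\<^sup>T = c \<cdot>\<^sub>m A\<^sup>T"
      by (intro eq_matI) auto
    ultimately show ?case
      using Y_carrier by (simp add: mult_smult_distrib[of _ n n _ n])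
  qed
  then show ?thesis by simp
qed

lemma zero_in_generated_algebra:
  fixes S :: "'k::field mat set"
  assumes "S \<subseteq> carrier_mat n n"
  shows "0\<^sub>m n n \<in> generated_algebra n S"
proof -
  interpret matrix_vs n n "TYPE('k)" .
  show ?thesis
    using matrix_products_carrier[OF assms] submodule.zero_closed[OF span_is_submodule[of "matrix_products S"]]
    unfolding generated_algebra_def by (simp add: module_mat_simps)
qed

section \<open>Reduced quotient matrices\<close>

lemma reduced_quotient_carrier:
  "reduce_matrix (quotient_matrix cells A) \<in> carrier_mat (length cells) (length cells)"
  unfolding reduce_matrix_def quotient_matrix_def by simp

lemma reduced_quotient_entry:
  assumes "finite X" "cell_partition X cells" "equitable_for cells A"
    and "a < length cells" "b < length cells" "x \<in> cells ! a"
  shows "reduce_matrix (quotient_matrix cells A) $$ (a, b) = of_int (\<Sum>y\<in>cells ! b. A x y)"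
proof -
  have "reduce_matrix (quotient_matrix cells A) $$ (a, b) = of_int \<lfloor>quotient_matrix cells A $$ (a, b)\<rfloor>"
    using assms(4,5) unfolding reduce_matrix_def quotient_matrix_def by simp
  then show ?thesis
    unfolding quotient_matrix_equitable[OF assms] floor_of_int .
qed

lemma cell_nonempty:
  assumes "cell_partition X cells" "a < length cells"
  obtains x where "x \<in> cells ! a"
  using assms unfolding cell_partition_def partition_on_def
  by (metis all_not_in_conv nth_mem)

lemma cell_subset:
  assumes "cell_partition X cells" "a < length cells"
  shows "cells ! a \<subseteq> X"
  using assms unfolding cell_partition_def partition_on_def
  by (metis Sup_upper nth_mem)

lemma sum_over_cells:
  fixes f :: "'a \<Rightarrow> int"
  assumes "finite X" and part: "cell_partition X cells"
  shows "(\<Sum>c<length cells. \<Sum>z\<in>cells ! c. f z) = (\<Sum>z\<in>X. f z)"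
proof -
  have X: "X = \<Union>(set cells)" and disj: "disjoint (set cells)" and dist: "distinct cells"
    using part unfolding cell_partition_def partition_on_def by auto
  have fin: "finite C" if "C \<in> set cells" for C
    using that assms(1) X by (metis Sup_upper finite_subset)
  have "(\<Sum>c<length cells. \<Sum>z\<in>cells ! c. f z) = (\<Sum>C\<in>set cells. \<Sum>z\<in>C. f z)"
    using sum.reindex_bij_betw[OF bij_betw_nth[OF dist refl refl], of "\<lambda>C. \<Sum>z\<in>C. f z"] by simp
  also have "\<dots> = (\<Sum>z\<in>X. f z)"
    unfolding X using sum.Union_disjoint[of "set cells" f] fin disj
    by (simp add: disjoint_def)
  finally show ?thesis .
qed

text \<open>Quotients by an equitable partition are multiplicative: the right-hand side is the \<open>(a, b)\<close> block
  row sum of the product of \<open>A\<close> and \<open>B\<close>. In the product of the quotients, the block row sum of \<open>B\<close> from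
  cell \<open>c\<close> to cell \<open>b\<close> may be taken at any row of cell \<open>c\<close>. Taking it at the row \<open>z\<close> that is the summation
  index of the block row sum of \<open>A\<close> makes the sum over the cells \<open>c\<close> a sum over all of \<open>X\<close>.\<close>

lemma reduced_quotient_mult_entry:
  assumes fin: "finite X" and part: "cell_partition X cells"
    and eqA: "equitable_for cells A" and eqB: "equitable_for cells B"
    and a: "a < length cells" and b: "b < length cells" and x: "x \<in> cells ! a"
  shows "(reduce_matrix (quotient_matrix cells A) * reduce_matrix (quotient_matrix cells B)) $$ (a, b)
    = (of_int (\<Sum>y\<in>cells ! b. \<Sum>z\<in>X. A x z * B z y) :: 'k::field)"
proof -
  let ?n = "length cells"
  define M N :: "'k mat" where "M = reduce_matrix (quotient_matrix cells A)"
    and "N = reduce_matrix (quotient_matrix cells B)"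
  have carr: "M \<in> carrier_mat ?n ?n" "N \<in> carrier_mat ?n ?n"
    unfolding M_def N_def by (rule reduced_quotient_carrier)+
  have entry: "M $$ (a, c) * N $$ (c, b) = of_int (\<Sum>z\<in>cells ! c. A x z * (\<Sum>y\<in>cells ! b. B z y))"
    if c: "c < ?n" for c
  proof -
    have N: "N $$ (c, b) = of_int (\<Sum>y\<in>cells ! b. B z y)" if "z \<in> cells ! c" for z
      unfolding N_def by (rule reduced_quotient_entry[OF fin part eqB c b that])
    have "M $$ (a, c) = of_int (\<Sum>z\<in>cells ! c. A x z)"
      unfolding M_def by (rule reduced_quotient_entry[OF fin part eqA a c x])
    then have "M $$ (a, c) * N $$ (c, b) = (\<Sum>z\<in>cells ! c. of_int (A x z) * N $$ (c, b))"
      by (simp add: sum_distrib_right)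
    also have "\<dots> = (\<Sum>z\<in>cells ! c. of_int (A x z) * of_int (\<Sum>y\<in>cells ! b. B z y))"
      using N by (intro sum.cong refl) simp
    finally show ?thesis
      by simp
  qed
  have "(M * N) $$ (a, b) = (\<Sum>c<?n. M $$ (a, c) * N $$ (c, b))"
    using carr a b by (simp add: scalar_prod_def atLeast0LessThan)
  also have "\<dots> = (\<Sum>c<?n. of_int (\<Sum>z\<in>cells ! c. A x z * (\<Sum>y\<in>cells ! b. B z y)))"
    using entry by (intro sum.cong refl) simp
  also have "\<dots> = of_int (\<Sum>c<?n. \<Sum>z\<in>cells ! c. A x z * (\<Sum>y\<in>cells ! b. B z y))"
    by simp
  also have "(\<Sum>c<?n. \<Sum>z\<in>cells ! c. A x z * (\<Sum>y\<in>cells ! b. B z y))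
      = (\<Sum>z\<in>X. A x z * (\<Sum>y\<in>cells ! b. B z y))"
    by (rule sum_over_cells[OF fin part])
  also have "\<dots> = (\<Sum>y\<in>cells ! b. \<Sum>z\<in>X. A x z * B z y)"
    unfolding sum_distrib_left by (rule sum.swap)
  finally show ?thesis
    unfolding M_def N_def .
qed

text \<open>Symmetry of \<open>A\<close> only says that the blocks \<open>(a, b)\<close> and \<open>(b, a)\<close> have the same total; equal cell
  sizes turn this into equality of the averages.\<close>

lemma reduced_quotient_symmetric:
  assumes fin: "finite X" and part: "cell_partition X cells" and eqA: "equitable_for cells A"
    and sym: "\<And>x y. A x y = A y x"
    and size: "\<And>C. C \<in> set cells \<Longrightarrow> card C = m"
  shows "(reduce_matrix (quotient_matrix cells A))\<^sup>T = (reduce_matrix (quotient_matrix cells A) :: 'k::field mat)"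
proof -
  have "quotient_matrix cells A $$ (a, b) = quotient_matrix cells A $$ (b, a)"
    if "a < length cells" "b < length cells" for a b
  proof -
    have "(\<Sum>x\<in>cells ! a. \<Sum>y\<in>cells ! b. rat_of_int (A x y))
        = (\<Sum>x\<in>cells ! b. \<Sum>y\<in>cells ! a. rat_of_int (A x y))"
      by (subst sum.swap) (simp add: sym)
    then show ?thesis
      using that size unfolding quotient_matrix_def by simp
  qed
  then show ?thesis
    unfolding reduce_matrix_def by (intro eq_matI) (auto simp: quotient_matrix_def)
qed

section \<open>Association schemes modulo a prime\<close>

lemma adjacency_mult:
  assumes P: "intersection_numbers X d R P" and fin: "finite X"
    and "i \<le> d" "j \<le> d" "k \<le> d" and xy: "(x, y) \<in> R k"
  shows "(\<Sum>z\<in>X. adjacency (R i) x z * adjacency (R j) z y) = int (P i j k)"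
proof -
  have "(\<Sum>z\<in>X. adjacency (R i) x z * adjacency (R j) z y)
      = (\<Sum>z\<in>X. if (x, z) \<in> R i \<and> (z, y) \<in> R j then 1 else 0)"
    unfolding adjacency_def by (intro sum.cong refl) auto
  also have "\<dots> = int (card {z \<in> X. (x, z) \<in> R i \<and> (z, y) \<in> R j})"
    using fin by (simp add: sum.If_cases Int_def)
  also have "\<dots> = int (P i j k)"
    using assms unfolding intersection_numbers_def by fastforce
  finally show ?thesis .
qed

text \<open>The translation by \<open>1\<close> permutes a finite ring, so summing over all elements before and after it
  gives the same value.\<close>

lemma of_nat_card_UNIV_eq_0: "of_nat CARD('k) = (0 :: 'k::{ring_1,finite})"
proof -
  have "(\<Sum>x\<in>UNIV. x) = (\<Sum>x\<in>UNIV. x + 1 :: 'k)"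
    by (rule sum.reindex_bij_witness[of _ "\<lambda>x. x + 1" "\<lambda>x. x - 1"]) auto
  then show ?thesis
    by (simp add: sum.distrib)
qed

lemma of_int_eq_0_if_dvd:
  assumes "CARD('k::{field,finite}) = p ^ r" and "int p dvd m"
  shows "(of_int m :: 'k) = 0"
proof -
  have "(of_nat p :: 'k) ^ r = 0"
    using of_nat_card_UNIV_eq_0[where 'k = 'k] assms(1) by simp
  then have "(of_nat p :: 'k) = 0"
    by simp
  then show ?thesis
    using assms(2) by auto
qed

text \<open>Every pair \<open>(x, y)\<close> lies in some \<open>R k\<close>, so each \<open>(x, y)\<close> entry of \<open>A\<^sub>i A\<^sub>j\<close> is an intersection
  number and vanishes modulo \<open>p\<close>; the quotient inherits this by multiplicativity.\<close>

lemma reduced_quotient_mult_eq_0: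
  assumes scheme: "association_scheme X d R" and P: "intersection_numbers X d R P"
    and equi: "equitable_partition X d R cells"
    and i: "i \<le> d" and j: "j \<le> d" and dvd: "\<And>k. k \<le> d \<Longrightarrow> p dvd P i j k"
    and card: "CARD('k::{field,finite}) = p ^ r"
  shows "reduce_matrix (quotient_matrix cells (adjacency (R i)))
      * reduce_matrix (quotient_matrix cells (adjacency (R j)))
    = (0\<^sub>m (length cells) (length cells) :: 'k mat)" (is "?M * ?N = _")
proof (rule eq_matI)
  fix a b
  assume "a < dim_row (0\<^sub>m (length cells) (length cells) :: 'k mat)"
    and "b < dim_col (0\<^sub>m (length cells) (length cells) :: 'k mat)"
  then have a: "a < length cells" and b: "b < length cells"
    by auto
  have fin: "finite X" and R: "partition_on (X \<times> X) (R ` {0..d})"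
    using scheme unfolding association_scheme_def by auto
  have part: "cell_partition X cells" and
    eq: "equitable_for cells (adjacency (R i))" "equitable_for cells (adjacency (R j))"
    using equi i j unfolding equitable_partition_def by auto
  obtain x where x: "x \<in> cells ! a"
    using cell_nonempty[OF part a] .
  have "int p dvd (\<Sum>y\<in>cells ! b. \<Sum>z\<in>X. adjacency (R i) x z * adjacency (R j) z y)"
  proof (rule dvd_sum)
    fix y assume "y \<in> cells ! b"
    then have "(x, y) \<in> \<Union>(R ` {0..d})"
      using x cell_subset[OF part a] cell_subset[OF part b] R unfolding partition_on_def by blast
    then obtain k where "k \<le> d" "(x, y) \<in> R k"
      by auto
    then show "int p dvd (\<Sum>z\<in>X. adjacency (R i) x z * adjacency (R j) z y)"
      using adjacency_mult[OF P fin i j] dvd by simp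
  qed
  then show "(?M * ?N) $$ (a, b) = 0\<^sub>m (length cells) (length cells) $$ (a, b)"
    unfolding reduced_quotient_mult_entry[OF fin part eq a b x]
    unfolding index_zero_mat(1)[OF a b] by (rule of_int_eq_0_if_dvd[OF card])
qed (auto simp: reduce_matrix_def quotient_matrix_def)

theorem theorem3:
  fixes X :: "'a set"
    and R :: "nat \<Rightarrow> ('a \<times> 'a) set"
    and P :: "nat \<Rightarrow> nat \<Rightarrow> nat \<Rightarrow> nat"
    and cells :: "'a set list"
    and I :: "nat set"
    and d t p r :: nat
    and M :: "nat \<Rightarrow> rat mat"
    and Malg :: "'k::{field,finite} mat set"
  assumes "association_scheme X d R"
    and "intersection_numbers X d R P"
    and "equitable_partition X d R cells"
    and "length cells = t"
    and "\<forall>C\<in>set cells. real (card C) = real (card X) / real t"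
    and "\<forall>i\<le>d. M i = quotient_matrix cells (adjacency (R i))"
    and "I \<subseteq> {0..d}"
    and "prime p"
    and "\<forall>k\<in>{0..d}. \<forall>i\<in>I. \<forall>j\<in>I. p dvd P i j k"
    and "r > 0"
    and "CARD('k) = p ^ r"
    and "Malg = generated_algebra t ((\<lambda>i. reduce_matrix (M i)) ` I)"
    and "Malg \<noteq> {0\<^sub>m t t}"
  shows "lcd_subspace_code (2 * t)
    {vec_space.row_space (2 * t) (append_columns Y (\<alpha> \<cdot>\<^sub>m 1\<^sub>m t)) | Y \<alpha>.
       Y \<in> Malg - {0\<^sub>m t t} \<and> \<alpha> \<in> UNIV - {0}}"
proof -
  let ?S = "(\<lambda>i. reduce_matrix (M i)) ` I :: 'k mat set"
  have fin: "finite X" and part: "cell_partition X cells"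
    using assms(1,3) unfolding association_scheme_def equitable_partition_def by auto
  have M: "M i = quotient_matrix cells (adjacency (R i))" and i_le: "i \<le> d" if "i \<in> I" for i
    using that assms(6,7) by auto
  have S: "?S \<subseteq> carrier_mat t t"
    using M reduced_quotient_carrier assms(4) by force
  have size: "card C = card (hd cells)" if "C \<in> set cells" for C
  proof -
    have "hd cells \<in> set cells"
      using that by (cases cells) auto
    then have "real (card C) = real (card (hd cells))"
      using that assms(5) by simp
    then show ?thesis
      by simp
  qed
  have S_sym: "A\<^sup>T = A" if A: "A \<in> ?S" for A
  proof -
    obtain i where i: "i \<in> I" and A_eq: "A = reduce_matrix (M i)"
      using A by auto
    have "sym (R i)" and "equitable_for cells (adjacency (R i))"
      using assms(1,3) i_le[OF i] unfolding association_scheme_def equitable_partition_def by auto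
    then show ?thesis
      unfolding A_eq M[OF i]
      by (intro reduced_quotient_symmetric[OF fin part _ _ size]) (auto simp: adjacency_def sym_def)
  qed
  have S_null: "A * B = 0\<^sub>m t t" if "A \<in> ?S" "B \<in> ?S" for A B
  proof -
    obtain i j where ij: "i \<in> I" "j \<in> I" and AB: "A = reduce_matrix (M i)" "B = reduce_matrix (M j)"
      using \<open>A \<in> ?S\<close> \<open>B \<in> ?S\<close> by (elim imageE)
    have "p dvd P i j k" if "k \<le> d" for k
      using assms(9) ij that by auto
    then show ?thesis
      using reduced_quotient_mult_eq_0[OF assms(1,2,3) i_le i_le _ assms(11)] ij assms(4)
      unfolding AB by (simp add: M)
  qed
  have Malg: "Malg \<subseteq> carrier_mat t t"
    and null: "\<And>Y Z. Y \<in> Malg \<Longrightarrow> Z \<in> Malg \<Longrightarrow> Y * Z\<^sup>T = 0\<^sub>m t t"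
    unfolding assms(12)
    using generated_algebra_carrier[OF S]
      generated_algebra_mult_transpose[OF S S_sym S_null] by blast+
  define G where "G Y \<alpha> = append_columns Y (\<alpha> \<cdot>\<^sub>m 1\<^sub>m t)" for Y and \<alpha> :: 'k
  have G: "G Y \<alpha> \<in> carrier_mat t (2 * t)" if "Y \<in> Malg" for Y \<alpha>
    using append_columns_carrier[of Y t t "\<alpha> \<cdot>\<^sub>m 1\<^sub>m t" t] that Malg unfolding G_def by (auto simp: mult_2)
  have gram: "G Z \<beta> * (G Y \<alpha>)\<^sup>T = (\<beta> * \<alpha>) \<cdot>\<^sub>m 1\<^sub>m t" if "Y \<in> Malg" "Z \<in> Malg" for Y Z \<alpha> \<beta>
  proof -
    have "G Z \<beta> * (G Y \<alpha>)\<^sup>T = Z * Y\<^sup>T + (\<beta> \<cdot>\<^sub>m 1\<^sub>m t) * (\<alpha> \<cdot>\<^sub>m 1\<^sub>m t)\<^sup>T"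
      unfolding G_def using that Malg by (intro append_columns_mult_transpose[of _ t t _ t]) auto
    also have "\<dots> = (\<beta> * \<alpha>) \<cdot>\<^sub>m 1\<^sub>m t"
      unfolding null[OF that(2,1)]
      by (intro eq_matI) auto
    finally show ?thesis .
  qed
  interpret vec_space "TYPE('k)" "2 * t" .
  let ?C = "{row_space (G Y \<alpha>) | Y \<alpha>. Y \<in> Malg - {0\<^sub>m t t} \<and> \<alpha> \<in> UNIV - {0}}"
  have "0\<^sub>m t t \<in> Malg"
    unfolding assms(12) by (rule zero_in_generated_algebra[OF S])
  then obtain Y where "Y \<in> Malg - {0\<^sub>m t t}"
    using assms(13) by blast
  then have "row_space (G Y 1) \<in> ?C"
    by force
  moreover have "subspace class_ring U V" if U_C: "U \<in> ?C" for U
  proof -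
    obtain Y \<alpha> where "Y \<in> Malg" and U: "U = row_space (G Y \<alpha>)"
      using U_C by blast
    then have "set (rows (G Y \<alpha>)) \<subseteq> carrier_vec (2 * t)"
      using rows_carrier[of "G Y \<alpha>"] carrier_matD(2)[OF G] by simp
    then show ?thesis
      unfolding U row_space_def by (rule span_is_subspace)
  qed
  moreover have "U \<inter> orthogonal_complement W = {0\<^sub>v (2 * t)}" if U_C: "U \<in> ?C" and W_C: "W \<in> ?C" for U W
  proof -
    obtain Y \<alpha> where Y: "Y \<in> Malg" "\<alpha> \<noteq> 0" and U: "U = row_space (G Y \<alpha>)"
      using U_C by blast
    obtain Z \<beta> where Z: "Z \<in> Malg" "\<beta> \<noteq> 0" and W: "W = row_space (G Z \<beta>)"
      using W_C by blast
    show ?thesis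
      unfolding U W using G gram Y Z
      by (intro row_space_inter_orthogonal_complement[where c = "\<beta> * \<alpha>"]) auto
  qed
  ultimately show ?thesis
    unfolding lcd_subspace_code_def subspace_code_def G_def by blast
qed

end
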